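(* Let $X$ be an implicative involutive BE algebra. The following are equivalent: (a) $X$ is an implicative-orthomodular lattice; (b) $x\to (x\Cap y)=x\to y$ for all $x,y\in X$; (c) $x\to (y\Cap (z\Cap x))=(x\to y)\Cap (x\to z)$ for all $x,y,z\in X$; (d) $x\to ((x\Cap y)\Cap (z\Cap x))=(x\to y)\Cap (x\to z)$ for all $x,y,z\in X$.
   Context: A BE algebra is an algebra $(X,\to,1)$ of type $(2,0)$ such that for all $x,y,z\in X$: $x\to x=1$; $x\to 1=1$; $1\to x=x$; $x\to(y\to z)=y\to(x\to z)$. Write $x\le y$ iff $x\to y=1$. It is bounded if there is $0\in X$ with $0\le x$ for all $x\in X$; then $x^*:=x\to 0$. A bounded BE algebra is involutive if $x^{**}=x$ for all $x$. A BE algebra is implicative if $(x\to y)\to x=x$ for all $x,y$. In an involutive BE algebra put $x\Cap y:=((x^*\to y^* )\to y^* )^*$. An implicative-orthomodular lattice is an implicative involutive BE algebra satisfying $x\Cap(y\to x)=x$ for all $x,y$. *)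

theory Defs imports Main begin

locale BE_algebra =
  fixes X :: "'a set"
    and imp :: "'a \<Rightarrow> 'a \<Rightarrow> 'a"  (infixr "\<rightarrow>" 65)
    and one :: 'a  ("\<one>")
  assumes imp_closed: "\<lbrakk>x \<in> X; y \<in> X\<rbrakk> \<Longrightarrow> x \<rightarrow> y \<in> X"
    and one_closed: "\<one> \<in> X"
    and imp_self: "x \<in> X \<Longrightarrow> x \<rightarrow> x = \<one>"
    and imp_one: "x \<in> X \<Longrightarrow> x \<rightarrow> \<one> = \<one>"
    and one_imp: "x \<in> X \<Longrightarrow> \<one> \<rightarrow> x = x"
    and imp_exchange: "\<lbrakk>x \<in> X; y \<in> X; z \<in> X\<rbrakk> \<Longrightarrow> x \<rightarrow> (y \<rightarrow> z) = y \<rightarrow> (x \<rightarrow> z)"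

definition BE_le :: "('a \<Rightarrow> 'a \<Rightarrow> 'a) \<Rightarrow> 'a \<Rightarrow> 'a \<Rightarrow> 'a \<Rightarrow> bool" where
  "BE_le imp one x y \<longleftrightarrow> imp x y = one"

(* The bottom element is a parameter, since the complement refers to it. In general
   BE_le is not antisymmetric, so a bottom need not be unique; an involutive
   bounded BE algebra has only one (0' = (0' \<rightarrow> 0) \<rightarrow> 0 = 1 \<rightarrow> 0 = 0). *)
locale bounded_BE_algebra = BE_algebra +
  fixes zero :: 'a  ("\<zero>")
  assumes zero_closed: "\<zero> \<in> X"
    and zero_le: "x \<in> X \<Longrightarrow> BE_le imp one \<zero> x"

definition BE_compl :: "('a \<Rightarrow> 'a \<Rightarrow> 'a) \<Rightarrow> 'a \<Rightarrow> 'a \<Rightarrow> 'a" where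
  "BE_compl imp zero x = imp x zero"

locale involutive_BE_algebra = bounded_BE_algebra +
  assumes compl_compl: "x \<in> X \<Longrightarrow> BE_compl imp zero (BE_compl imp zero x) = x"

locale implicative_BE_algebra = BE_algebra +
  assumes implicative: "\<lbrakk>x \<in> X; y \<in> X\<rbrakk> \<Longrightarrow> (x \<rightarrow> y) \<rightarrow> x = x"

locale implicative_involutive_BE_algebra = involutive_BE_algebra + implicative_BE_algebra

definition BE_Cap :: "('a \<Rightarrow> 'a \<Rightarrow> 'a) \<Rightarrow> 'a \<Rightarrow> 'a \<Rightarrow> 'a \<Rightarrow> 'a" where
  "BE_Cap imp zero x y =
     BE_compl imp zero
       (imp (imp (BE_compl imp zero x) (BE_compl imp zero y)) (BE_compl imp zero y))"

locale implicative_orthomodular_lattice = implicative_involutive_BE_algebra +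
  assumes Cap_imp: "\<lbrakk>x \<in> X; y \<in> X\<rbrakk> \<Longrightarrow> BE_Cap imp zero x (y \<rightarrow> x) = x"

end

theory Submission imports Defs begin

text \<open>
  Put \<open>x \<squnion> y = x\<^sup>\<bottom> \<rightarrow> y\<close> and \<open>x \<sqinter> y = (x \<rightarrow> y\<^sup>\<bottom>)\<^sup>\<bottom>\<close>, with \<open>x\<^sup>\<bottom> = x \<rightarrow> \<zero>\<close>. The exchange
  law makes both operations commutative and associative, and implicativity is absorption, so an
  implicative involutive BE algebra is an ortholattice in which \<open>x \<rightarrow> y = x\<^sup>\<bottom> \<squnion> y\<close> and
  \<open>x \<Cap> y = y \<sqinter> (y\<^sup>\<bottom> \<squnion> x)\<close> is the Sasaki projection of \<open>x\<close> onto \<open>y\<close>.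
  Condition (a) and the identity \<open>x \<rightarrow> (z \<Cap> x) = x \<rightarrow> z\<close> are two forms of the orthomodular law;
  the latter is the case \<open>y = \<one>\<close> of (c) and of (d).
\<close>

context implicative_involutive_BE_algebra
begin

abbreviation compl :: "'a \<Rightarrow> 'a"  ("_\<^sup>\<bottom>" [1000] 999)
  where "x\<^sup>\<bottom> \<equiv> BE_compl imp zero x"

abbreviation Cap :: "'a \<Rightarrow> 'a \<Rightarrow> 'a"  (infixl "\<Cap>" 70)
  where "x \<Cap> y \<equiv> BE_Cap imp zero x y"

definition join :: "'a \<Rightarrow> 'a \<Rightarrow> 'a"  (infixl "\<squnion>" 66)
  where "x \<squnion> y = x\<^sup>\<bottom> \<rightarrow> y"

definition meet :: "'a \<Rightarrow> 'a \<Rightarrow> 'a"  (infixl "\<sqinter>" 68)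
  where "x \<sqinter> y = (x \<rightarrow> y\<^sup>\<bottom>)\<^sup>\<bottom>"

lemma imp_zero: "x \<rightarrow> \<zero> = x\<^sup>\<bottom>"
  by (simp add: BE_compl_def)

lemma compl_closed [simp]: "x \<in> X \<Longrightarrow> x\<^sup>\<bottom> \<in> X"
  by (simp add: BE_compl_def imp_closed zero_closed)

lemma join_closed [simp]: "\<lbrakk>x \<in> X; y \<in> X\<rbrakk> \<Longrightarrow> x \<squnion> y \<in> X"
  by (simp add: join_def imp_closed)

lemma meet_closed [simp]: "\<lbrakk>x \<in> X; y \<in> X\<rbrakk> \<Longrightarrow> x \<sqinter> y \<in> X"
  by (simp add: meet_def imp_closed)

declare one_closed [simp] zero_closed [simp] compl_compl [simp]

lemma imp_eq_join: "x \<in> X \<Longrightarrow> x \<rightarrow> y = x\<^sup>\<bottom> \<squnion> y"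
  by (simp add: join_def)

lemma compl_meet: "\<lbrakk>x \<in> X; y \<in> X\<rbrakk> \<Longrightarrow> (x \<sqinter> y)\<^sup>\<bottom> = x\<^sup>\<bottom> \<squnion> y\<^sup>\<bottom>"
  by (simp add: join_def meet_def imp_closed)

lemma compl_join: "\<lbrakk>x \<in> X; y \<in> X\<rbrakk> \<Longrightarrow> (x \<squnion> y)\<^sup>\<bottom> = x\<^sup>\<bottom> \<sqinter> y\<^sup>\<bottom>"
  by (simp add: join_def meet_def)

text \<open>Exchange with \<open>\<zero>\<close> in the last place swaps \<open>x\<close> and
  \<open>y\<close>, because \<open>y\<^sup>\<bottom> \<rightarrow> \<zero>\<close> is
  \<open>y\<close> again.\<close>

lemma join_commute: "\<lbrakk>x \<in> X; y \<in> X\<rbrakk> \<Longrightarrow> x \<squnion> y = y \<squnion> x"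
  using imp_exchange [of "x\<^sup>\<bottom>" "y\<^sup>\<bottom>" \<zero>] by (simp add: join_def imp_zero)

lemma join_left_commute:
  "\<lbrakk>x \<in> X; y \<in> X; z \<in> X\<rbrakk> \<Longrightarrow> x \<squnion> (y \<squnion> z) = y \<squnion> (x \<squnion> z)"
  by (simp add: join_def imp_exchange)

lemma join_assoc:
  "\<lbrakk>x \<in> X; y \<in> X; z \<in> X\<rbrakk> \<Longrightarrow> x \<squnion> y \<squnion> z = x \<squnion> (y \<squnion> z)"
  by (metis join_closed join_commute join_left_commute)

lemma meet_commute: "\<lbrakk>x \<in> X; y \<in> X\<rbrakk> \<Longrightarrow> x \<sqinter> y = y \<sqinter> x"
  by (metis compl_closed compl_compl compl_join join_commute)

lemma meet_assoc:
  assumes [simp]: "x \<in> X" "y \<in> X" "z \<in> X"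
  shows "x \<sqinter> y \<sqinter> z = x \<sqinter> (y \<sqinter> z)"
proof -
  have "(x \<sqinter> y \<sqinter> z)\<^sup>\<bottom> = (x \<sqinter> (y \<sqinter> z))\<^sup>\<bottom>"
    by (simp add: compl_meet join_assoc)
  then show ?thesis
    by (metis assms compl_compl meet_closed)
qed

text \<open>Implicativity at \<open>x\<close> and \<open>y\<^sup>\<bottom>\<close>: the inner
  \<open>x \<rightarrow> y\<^sup>\<bottom>\<close> is the complement of
  \<open>x \<sqinter> y\<close>, so the outer arrow is a join with
  \<open>x \<sqinter> y\<close>.\<close>

lemma join_meet_absorb: "\<lbrakk>x \<in> X; y \<in> X\<rbrakk> \<Longrightarrow> x \<squnion> (x \<sqinter> y) = x"
  using implicative [of x "y\<^sup>\<bottom>"] join_commute [of x "x \<sqinter> y"]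
  by (simp add: join_def meet_def imp_closed)

lemma meet_join_absorb:
  assumes [simp]: "x \<in> X" "y \<in> X"
  shows "x \<sqinter> (x \<squnion> y) = x"
proof -
  have "(x \<sqinter> (x \<squnion> y))\<^sup>\<bottom> = x\<^sup>\<bottom>"
    by (simp add: compl_meet compl_join join_meet_absorb)
  then show ?thesis
    by (metis assms compl_compl join_closed meet_closed)
qed

text \<open>Dedekind's argument: rewrite the second \<open>x\<close> as
  \<open>x \<sqinter> (x \<squnion> x)\<close> and absorb.\<close>

lemma join_idem: "x \<in> X \<Longrightarrow> x \<squnion> x = x"
  by (metis join_closed join_meet_absorb meet_join_absorb)

lemma compl_one: "\<one>\<^sup>\<bottom> = \<zero>"
  by (simp add: BE_compl_def one_imp)

lemma join_one: "x \<in> X \<Longrightarrow> x \<squnion> \<one> = \<one>"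
  by (simp add: join_def imp_one)

lemma join_zero: "x \<in> X \<Longrightarrow> x \<squnion> \<zero> = x"
  by (simp add: join_def imp_zero)

lemma meet_one: "x \<in> X \<Longrightarrow> x \<sqinter> \<one> = x"
  by (simp add: meet_def compl_one imp_zero)

lemma compl_join_self: "x \<in> X \<Longrightarrow> x\<^sup>\<bottom> \<squnion> x = \<one>"
  by (simp add: imp_self flip: imp_eq_join)

lemma Cap_eq: "\<lbrakk>x \<in> X; y \<in> X\<rbrakk> \<Longrightarrow> x \<Cap> y = y \<sqinter> (y\<^sup>\<bottom> \<squnion> x)"
  by (metis BE_Cap_def compl_closed compl_compl imp_eq_join join_closed
      join_commute meet_commute meet_def)

lemma Cap_closed [simp]: "\<lbrakk>x \<in> X; y \<in> X\<rbrakk> \<Longrightarrow> x \<Cap> y \<in> X"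
  by (simp add: Cap_eq)

lemma one_Cap: "x \<in> X \<Longrightarrow> \<one> \<Cap> x = x"
  by (simp add: Cap_eq join_one meet_one)

lemma Cap_one: "x \<in> X \<Longrightarrow> x \<Cap> \<one> = x"
  by (simp add: Cap_eq compl_one join_zero join_commute [of \<zero>] meet_one meet_commute [of \<one>])

text \<open>The elements \<open>y \<rightarrow> x\<close> are those above \<open>x\<close>, so (a)
  says \<open>x = b \<sqinter> (b\<^sup>\<bottom> \<squnion> x)\<close> whenever \<open>x\<close> is
  below \<open>b\<close>. The elements \<open>x \<rightarrow> z\<close> are those above
  \<open>x\<^sup>\<bottom>\<close>, so the right side says
  \<open>u = x\<^sup>\<bottom> \<squnion> (x \<sqinter> u)\<close> for each such \<open>u\<close>.
  Complementation exchanges the two.\<close>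

lemma orthomodular_iff:
  "implicative_orthomodular_lattice X imp one zero \<longleftrightarrow>
    (\<forall>x\<in>X. \<forall>z\<in>X. x \<rightarrow> (z \<Cap> x) = x \<rightarrow> z)"
proof -
  have "implicative_orthomodular_lattice X imp one zero \<longleftrightarrow>
      (\<forall>x\<in>X. \<forall>y\<in>X. x \<Cap> (y \<rightarrow> x) = x)"
    by (simp add: implicative_orthomodular_lattice_def implicative_orthomodular_lattice_axioms_def
        implicative_involutive_BE_algebra_axioms Ball_def)
  also have "\<dots> \<longleftrightarrow> (\<forall>x\<in>X. \<forall>z\<in>X. x \<rightarrow> (z \<Cap> x) = x \<rightarrow> z)"
  proof (intro iffI ballI)
    fix x z assume *: "\<forall>x\<in>X. \<forall>y\<in>X. x \<Cap> (y \<rightarrow> x) = x" and [simp]: "x \<in> X" "z \<in> X"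
    let ?u = "x\<^sup>\<bottom> \<squnion> z"
    \<comment> \<open>\<open>?u\<^sup>\<bottom>\<close> lies below \<open>x\<close>; this equation
      brings the pair into the form that (a) needs.\<close>
    have "x\<^sup>\<bottom> \<rightarrow> ?u\<^sup>\<bottom> = x"
      by (simp add: imp_eq_join compl_join join_meet_absorb)
    then have "?u\<^sup>\<bottom> \<Cap> x = ?u\<^sup>\<bottom>"
      using * by (metis \<open>x \<in> X\<close> \<open>z \<in> X\<close> compl_closed join_closed)
    then have "(?u\<^sup>\<bottom> \<Cap> x)\<^sup>\<bottom> = ?u"
      by simp
    then show "x \<rightarrow> (z \<Cap> x) = x \<rightarrow> z"
      by (simp add: Cap_eq imp_eq_join compl_meet compl_join)
  next
    fix x y assume *: "\<forall>x\<in>X. \<forall>z\<in>X. x \<rightarrow> (z \<Cap> x) = x \<rightarrow> z" and [simp]: "x \<in> X" "y \<in> X"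
    let ?b = "y\<^sup>\<bottom> \<squnion> x"
    \<comment> \<open>\<open>?b\<close> is \<open>y \<rightarrow> x\<close>, which lies above
      \<open>x\<close>, so \<open>?b\<^sup>\<bottom>\<close> lies below
      \<open>x\<^sup>\<bottom>\<close>.\<close>
    have le: "?b\<^sup>\<bottom> \<squnion> x\<^sup>\<bottom> = x\<^sup>\<bottom>"
      by (simp add: compl_join join_commute [of _ "x\<^sup>\<bottom>"] meet_commute [of y] join_meet_absorb)
    have "?b \<rightarrow> (x\<^sup>\<bottom> \<Cap> ?b) = ?b \<rightarrow> x\<^sup>\<bottom>"
      using * by simp
    then have "?b\<^sup>\<bottom> \<squnion> (?b \<sqinter> x\<^sup>\<bottom>) = x\<^sup>\<bottom>"
      by (simp add: Cap_eq imp_eq_join le)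
    then have "(?b\<^sup>\<bottom> \<squnion> (?b \<sqinter> x\<^sup>\<bottom>))\<^sup>\<bottom> = x"
      by simp
    then have "?b \<sqinter> (?b\<^sup>\<bottom> \<squnion> x) = x"
      by (simp add: compl_meet compl_join [of "?b\<^sup>\<bottom>"])
    then show "x \<Cap> (y \<rightarrow> x) = x"
      by (simp add: Cap_eq imp_eq_join)
  qed
  finally show ?thesis .
qed

lemma orthomodular_iff_imp_Cap:
  "implicative_orthomodular_lattice X imp one zero \<longleftrightarrow>
    (\<forall>x\<in>X. \<forall>y\<in>X. x \<rightarrow> (x \<Cap> y) = x \<rightarrow> y)"
  unfolding orthomodular_iff
proof (intro iffI ballI)
  fix x z assume *: "\<forall>x\<in>X. \<forall>y\<in>X. x \<rightarrow> (x \<Cap> y) = x \<rightarrow> y" and [simp]: "x \<in> X" "z \<in> X"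
  let ?u = "x\<^sup>\<bottom> \<squnion> z"
  \<comment> \<open>\<open>?u\<^sup>\<bottom>\<close> lies below \<open>x\<close>, so projecting
    \<open>x\<close> onto \<open>?u\<close> gives just \<open>?u \<sqinter> x\<close>, which is also
    the projection of \<open>z\<close> onto \<open>x\<close>. Hence (b) is used at \<open>x\<close>
    and \<open>?u\<close>.\<close>
  have "x \<Cap> ?u = z \<Cap> x"
    by (simp add: Cap_eq compl_join join_commute [of _ x] join_meet_absorb meet_commute [of _ x])
  moreover have "x \<rightarrow> ?u = x \<rightarrow> z"
    by (simp add: imp_eq_join join_idem flip: join_assoc)
  ultimately show "x \<rightarrow> (z \<Cap> x) = x \<rightarrow> z"
    using * by (metis \<open>x \<in> X\<close> \<open>z \<in> X\<close> compl_closed join_closed)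
next
  fix x y assume *: "\<forall>x\<in>X. \<forall>z\<in>X. x \<rightarrow> (z \<Cap> x) = x \<rightarrow> z" and [simp]: "x \<in> X" "y \<in> X"
  let ?v = "y\<^sup>\<bottom> \<squnion> x"
  \<comment> \<open>\<open>x \<Cap> y\<close> is \<open>y \<sqinter> ?v\<close>, and
    \<open>?v\<^sup>\<bottom> = y \<sqinter> x\<^sup>\<bottom>\<close> lies below both
    \<open>y\<close> and \<open>x\<^sup>\<bottom>\<close>. Orthomodularity splits \<open>y\<close>
    into \<open>?v\<^sup>\<bottom>\<close> and \<open>?v \<sqinter> y\<close>; joining with
    \<open>x\<^sup>\<bottom>\<close> swallows the first piece.\<close>
  have "?v\<^sup>\<bottom> \<squnion> (?v \<sqinter> (?v\<^sup>\<bottom> \<squnion> y)) = ?v\<^sup>\<bottom> \<squnion> y"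
    using * [rule_format, of ?v y] by (simp add: Cap_eq imp_eq_join)
  moreover have "?v\<^sup>\<bottom> \<squnion> y = y"
    by (simp add: compl_join join_commute [of _ y] join_meet_absorb)
  ultimately have v: "?v\<^sup>\<bottom> \<squnion> (?v \<sqinter> y) = y"
    by simp
  have "x\<^sup>\<bottom> \<squnion> ?v\<^sup>\<bottom> = x\<^sup>\<bottom>"
    by (simp add: compl_join meet_commute [of y] join_meet_absorb)
  then have "x\<^sup>\<bottom> \<squnion> (?v \<sqinter> y) = x\<^sup>\<bottom> \<squnion> (?v\<^sup>\<bottom> \<squnion> (?v \<sqinter> y))"
    by (simp flip: join_assoc)
  with v show "x \<rightarrow> (x \<Cap> y) = x \<rightarrow> y"
    by (simp add: Cap_eq imp_eq_join meet_commute [of y])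
qed

text \<open>The right side is an element \<open>?a \<sqinter> ?b\<close> above
  \<open>x\<^sup>\<bottom>\<close>, and the nested projection on the left is its meet with
  \<open>x\<close>. Orthomodularity recovers the element from that meet.\<close>

lemma imp_Cap_Cap:
  assumes "implicative_orthomodular_lattice X imp one zero"
    and [simp]: "x \<in> X" "y \<in> X" "z \<in> X"
  shows "x \<rightarrow> (y \<Cap> (z \<Cap> x)) = (x \<rightarrow> y) \<Cap> (x \<rightarrow> z)"
proof -
  have *: "x\<^sup>\<bottom> \<squnion> (x \<sqinter> (x\<^sup>\<bottom> \<squnion> q)) = x\<^sup>\<bottom> \<squnion> q" if "q \<in> X" for q
    using assms that by (simp add: orthomodular_iff Cap_eq imp_eq_join)
  let ?a = "x\<^sup>\<bottom> \<squnion> z" and ?b = "x\<^sup>\<bottom> \<squnion> ((x \<sqinter> z\<^sup>\<bottom>) \<squnion> y)"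
  have "?a \<sqinter> ?b = x\<^sup>\<bottom> \<squnion> (?a \<sqinter> ?b)"
  proof -
    have "x\<^sup>\<bottom> \<sqinter> (?a \<sqinter> ?b) = x\<^sup>\<bottom>"
      by (simp add: meet_join_absorb flip: meet_assoc)
    then show ?thesis
      by (metis assms(2-4) compl_closed join_closed join_commute join_meet_absorb meet_closed
          meet_commute)
  qed
  moreover from this have "x\<^sup>\<bottom> \<squnion> (x \<sqinter> (?a \<sqinter> ?b)) = ?a \<sqinter> ?b"
    using * [of "?a \<sqinter> ?b"] by simp
  moreover have "y \<Cap> (z \<Cap> x) = x \<sqinter> (?a \<sqinter> ?b)"
    by (simp add: Cap_eq compl_meet compl_join meet_assoc join_assoc)
  moreover have "(x \<rightarrow> y) \<Cap> (x \<rightarrow> z) = ?a \<sqinter> ?b"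
    by (simp add: Cap_eq imp_eq_join compl_join join_left_commute)
  ultimately show ?thesis
    by (simp add: imp_eq_join)
qed

lemma orthomodular_iff_imp_Cap_Cap:
  "implicative_orthomodular_lattice X imp one zero \<longleftrightarrow>
    (\<forall>x\<in>X. \<forall>y\<in>X. \<forall>z\<in>X. x \<rightarrow> (y \<Cap> (z \<Cap> x)) = (x \<rightarrow> y) \<Cap> (x \<rightarrow> z))"
proof (intro iffI)
  assume *: "\<forall>x\<in>X. \<forall>y\<in>X. \<forall>z\<in>X. x \<rightarrow> (y \<Cap> (z \<Cap> x)) = (x \<rightarrow> y) \<Cap> (x \<rightarrow> z)"
  have "x \<rightarrow> (z \<Cap> x) = x \<rightarrow> z" if "x \<in> X" "z \<in> X" for x z
    using * [rule_format, of x \<one> z] that by (simp add: imp_one one_Cap imp_closed)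
  then show "implicative_orthomodular_lattice X imp one zero"
    by (simp add: orthomodular_iff)
qed (simp add: imp_Cap_Cap)

lemma orthomodular_iff_imp_Cap_Cap_Cap:
  "implicative_orthomodular_lattice X imp one zero \<longleftrightarrow>
    (\<forall>x\<in>X. \<forall>y\<in>X. \<forall>z\<in>X. x \<rightarrow> ((x \<Cap> y) \<Cap> (z \<Cap> x)) = (x \<rightarrow> y) \<Cap> (x \<rightarrow> z))"
proof (intro iffI)
  assume *: "\<forall>x\<in>X. \<forall>y\<in>X. \<forall>z\<in>X. x \<rightarrow> ((x \<Cap> y) \<Cap> (z \<Cap> x)) = (x \<rightarrow> y) \<Cap> (x \<rightarrow> z)"
  have "x \<rightarrow> (z \<Cap> x) = x \<rightarrow> z" if [simp]: "x \<in> X" "z \<in> X" for x z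
  proof -
    \<comment> \<open>With \<open>w = z \<Cap> x\<close> below \<open>x\<close>, the join
      \<open>w\<^sup>\<bottom> \<squnion> x\<close> is above
      \<open>x\<^sup>\<bottom> \<squnion> x = \<one>\<close>, so projecting \<open>x\<close> onto
      \<open>w\<close> yields all of \<open>w\<close>.\<close>
    have "x \<Cap> (z \<Cap> x) = z \<Cap> x"
      using join_left_commute [of "x \<sqinter> z\<^sup>\<bottom>" "x\<^sup>\<bottom>" x]
      by (simp add: Cap_eq compl_meet compl_join meet_assoc join_assoc join_commute [of "x \<sqinter> _" x]
          join_meet_absorb compl_join_self meet_one)
    then show ?thesis
      using * [rule_format, of x \<one> z] by (simp add: imp_one one_Cap Cap_one imp_closed)
  qed
  then show "implicative_orthomodular_lattice X imp one zero"
    by (simp add: orthomodular_iff)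
next
  assume *: "implicative_orthomodular_lattice X imp one zero"
  \<comment> \<open>Condition (d) is (c) with \<open>x \<Cap> y\<close> in place of
    \<open>y\<close>; by (b) this replacement leaves the right side unchanged.\<close>
  then have "x \<rightarrow> (x \<Cap> y) = x \<rightarrow> y" if "x \<in> X" "y \<in> X" for x y
    using that by (simp add: orthomodular_iff_imp_Cap)
  with * show "\<forall>x\<in>X. \<forall>y\<in>X. \<forall>z\<in>X. x \<rightarrow> ((x \<Cap> y) \<Cap> (z \<Cap> x)) = (x \<rightarrow> y) \<Cap> (x \<rightarrow> z)"
    by (simp add: imp_Cap_Cap)
qed

end

theorem theorem3p10:
  fixes X :: "'a set"
    and imp :: "'a \<Rightarrow> 'a \<Rightarrow> 'a"  (infixr "\<rightarrow>" 65)
    and one zero :: 'a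
    and Cap :: "'a \<Rightarrow> 'a \<Rightarrow> 'a"  (infixl "\<Cap>" 70)
  defines "Cap \<equiv> BE_Cap imp zero"
  assumes "implicative_involutive_BE_algebra X imp one zero"
  shows "(implicative_orthomodular_lattice X imp one zero \<longleftrightarrow>
            (\<forall>x\<in>X. \<forall>y\<in>X. x \<rightarrow> (x \<Cap> y) = x \<rightarrow> y))
       \<and> (implicative_orthomodular_lattice X imp one zero \<longleftrightarrow>
            (\<forall>x\<in>X. \<forall>y\<in>X. \<forall>z\<in>X. x \<rightarrow> (y \<Cap> (z \<Cap> x)) = (x \<rightarrow> y) \<Cap> (x \<rightarrow> z)))
       \<and> (implicative_orthomodular_lattice X imp one zero \<longleftrightarrow>
            (\<forall>x\<in>X. \<forall>y\<in>X. \<forall>z\<in>X. x \<rightarrow> ((x \<Cap> y) \<Cap> (z \<Cap> x)) = (x \<rightarrow> y) \<Cap> (x \<rightarrow> z)))"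
proof -
  interpret implicative_involutive_BE_algebra X imp one zero by fact
  show ?thesis
    unfolding Cap_def
    using orthomodular_iff_imp_Cap orthomodular_iff_imp_Cap_Cap orthomodular_iff_imp_Cap_Cap_Cap
    by blast
qed

end
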